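(* In the setting of the context, denote by $\mathbf{h}=(h_1,\dots,h_m)^T$ a bandwidth vector that assigns a constant bandwidth to each block ($h_{ij}=h_i$ for all $j$). The bandwidth vector $\mathbf{h}_{opt}$ that minimizes the second-order approximation of the MISE (up to order $h^3$) of the DDEVD estimator is given by $$\mathbf{h}_{opt}=-\tfrac12\,\mathbf{Q}^{-1}\mathbf{c},$$ where $\mathbf{c}\in\mathbb{R}^m$ is the vector of coefficients for the linear terms in $\mathbf{h}$ and $\mathbf{Q}\in\mathbb{R}^{m\times m}$ is the Hessian matrix of the quadratic terms in $\mathbf{h}$ from the MISE expansion, with components $$c_i=\int\Big(2\Big(\sum_{j=1}^mb_{0,j}(y)\Big)b_{1,i}(y)+V_{1,i}(y)\Big)\,\mathrm{d}y,$$ $$Q_{kl}=\int\Big(b_{1,k}(y)b_{1,l}(y)+\delta_{kl}\Big(2\sum_{j=1}^mb_{0,j}(y)\,b_{2,k}(y)+V_{2,k}(y)\Big)\Big)\,\mathrm{d}y,$$ where $b_{2,k}=b_{2a,k}+b_{2b,k}$, $V_{2,k}=V_{2a,k}+V_{2b,k}$ and $\delta_{kl}$ is the Kronecker delta. The optimal bandwidth vector obtained in this fashion is optimal also in a global sense, i.e. it also optimizes all individual bandwidths $h_{ij}$.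
   Context: Setting. Let $m,n_1,\dots,n_m\in\mathbb{N}_{>0}$ and let $X_{ij}$ ($1\le i\le m$, $1\le j\le n_i$) be i.i.d. with at least twice continuously differentiable CDF $F_X$, $f_X=F_X'$. Let $K$ be a CDF kernel (non-decreasing, limits $0$ at $-\infty$ and $1$ at $\infty$) such that the distributions described by $K$ and $K^2$ have at least first and second moments. For a matrix of bandwidths $h=(h_{ij})$, $h_{ij}>0$, the DDEVD (data driven extreme value distribution) estimator is $\hat F_h(y)=\frac1m\sum_iF_{i,h}(y)^{n_i}$ with $F_{i,h}(y)=\frac1{n_i}\sum_jK\big(\frac{y-X_{ij}}{h_{ij}}\big)$; the target CDF is $F(y)=\frac1m\sum_iF_X(y)^{n_i}$. The MISE is $\mathbb{E}\int(\hat F_h(y)-F(y))^2\,\mathrm{d}y$. Second-order approximation of the MISE. With $\bar h_i=\frac1{n_i}\sum_jh_{ij}$, $\overline{h_i^2}=\frac1{n_i}\sum_jh_{ij}^2$, $\bar h_i^{\,2}=(\bar h_i)^2$, the mean squared error $\mathbb{E}[(\hat F_h(y)-F(y))^2]$ is expanded up to $\mathcal{O}(h^3)$ as $$\frac1{m^2}\Big[\Big(\sum_ib_{0,i}\Big)^2+\sum_iV_{0,i}+2\Big(\sum_ib_{0,i}\Big)\Big(\sum_i\bar h_ib_{1,i}\Big)+\sum_i\bar h_iV_{1,i}+\Big(\sum_i\bar h_ib_{1,i}\Big)^2+2\Big(\sum_ib_{0,i}\Big)\sum_i\big(\overline{h_i^2}b_{2a,i}+\bar h_i^{\,2}b_{2b,i}\big)+\sum_i\big(\overline{h_i^2}V_{2a,i}+\bar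 h_i^{\,2}V_{2b,i}\big)\Big],$$ and the second-order approximation of the MISE is the integral over $y$ of this expression. All integrals are over $\mathbb{R}$ if the full MISE is considered, or over $[F_X^{-1}(q),\infty)$ if the $q$-quantile version of the MISE (squared error integrated over the upper tail only) is considered. Coefficients. The functions $b_{\cdot,i},V_{\cdot,i}$ of $y$ are the coefficients in the expansions $\mathbb{E}[F_{i,h}^{n_i}]-F_X^{n_i}=b_{0,i}+\bar h_ib_{1,i}+\overline{h_i^2}b_{2a,i}+\bar h_i^{\,2}b_{2b,i}+\mathcal{O}(h^3)$ and $\mathrm{Var}(F_{i,h}^{n_i})=V_{0,i}+\bar h_iV_{1,i}+\overline{h_i^2}V_{2a,i}+\bar h_i^{\,2}V_{2b,i}+\mathcal{O}(h^3)$, derived by approximating the central moments of $F_{i,h}(y)$ by normal moments. Explicitly, with $\mu_{K,p}=\int u^pK'(u)\,du$, $\mu_{K^2,p}=\int u^p(K^2)'(u)\,du$, $\alpha=f_X\mu_{K^2,1}-2F_Xf_X\mu_{K,1}$, $\beta=\frac12f_X'\mu_{K^2,2}-f_X'F_X\mu_{K,2}-f_X^2\mu_{K,1}^2$, $(-1)!!=1$, and for fixed $i$: $Y_{0,N}=\sum_{k=0}^{\lfloor N/2\rfloor}\binom N{2k}(2k-1)!!\,n_i^{-k}F_X^{N-k}(1-F_X)^k$, $Y_{1,N}=-\sum_{k=1}^{\lfloor N/2\rfloor}k\binom N{2k}(2k-1)!!\,n_i^{-k}F_X^{N-k-1}(1-F_X)^{k-1}\alpha$, $Y_{2\alpha,N}=\sum_{k=2}^{\lfloor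 N/2\rfloor}\binom N{2k}(2k-1)!!\,\frac{k(k-1)}2n_i^{-k}F_X^{N-k-2}(1-F_X)^{k-2}\alpha^2$, $Y_{2\beta,N}=\sum_{k=1}^{\lfloor N/2\rfloor}k\binom N{2k}(2k-1)!!\,n_i^{-k}F_X^{N-k-1}(1-F_X)^{k-1}\beta$, $E_{0,N}=Y_{0,N}$, $E_{1,N}=Y_{1,N}-Nf_X\mu_{K,1}Y_{0,N-1}$, $E_{2a,N}=Y_{2\beta,N}+\frac N2f_X'\mu_{K,2}Y_{0,N-1}$, $E_{2b,N}=Y_{2\alpha,N}-Nf_X\mu_{K,1}Y_{1,N-1}+\binom N2f_X^2\mu_{K,1}^2Y_{0,N-2}$, one has $b_{0,i}=E_{0,n_i}-F_X^{n_i}$, $b_{1,i}=E_{1,n_i}$, $b_{2a,i}=E_{2a,n_i}$, $b_{2b,i}=E_{2b,n_i}$, $V_{0,i}=E_{0,2n_i}-E_{0,n_i}^2$, $V_{1,i}=E_{1,2n_i}-2E_{0,n_i}E_{1,n_i}$, $V_{2a,i}=E_{2a,2n_i}-2E_{0,n_i}E_{2a,n_i}$, $V_{2b,i}=E_{2b,2n_i}-2E_{0,n_i}E_{2b,n_i}-E_{1,n_i}^2$.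
   Formalization: Global optimality over all h_ij is claimed only if a minimizer over individual bandwidths exists, shown equivalent to ∫(2Σb_{0,j} b_{2a,i}+V_{2a,i}) ≥ 0 for all i with n_i ≥ 2; otherwise h_opt is only stationary in each h_ij (fails e.g. for m=1, n_1=2, F=exp(-y^{-2}), K normal). *)

theory Defs
  imports "HOL-Probability.Probability"
begin

section \<open>Distribution functions, kernels and moments\<close>

definition cdf_function :: "(real \<Rightarrow> real) \<Rightarrow> bool" where
  "cdf_function G \<longleftrightarrow>
     mono G \<and> (\<forall>x. continuous (at_right x) G) \<and> (G \<longlongrightarrow> 0) at_bot \<and> (G \<longlongrightarrow> 1) at_top"

text \<open>The moment \<open>\<integral> u^p G'(u) du\<close> of the distribution described by \<open>G\<close>, as a Lebesgue--Stieltjes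
  integral \<open>\<integral> u^p dG(u)\<close>, so that \<open>G\<close> need not have a density.
  See \<open>cdf_moment_eq_deriv\<close> for the agreement with the formula involving \<open>G'\<close>.\<close>

definition cdf_moment :: "(real \<Rightarrow> real) \<Rightarrow> nat \<Rightarrow> real" where
  "cdf_moment G p = (LINT u|interval_measure G. u ^ p)"

lemma interval_measure_eq_density:
  assumes G: "cdf_function G"
    and diff: "\<And>x. (G has_real_derivative deriv G x) (at x)"
    and cont: "continuous_on UNIV (deriv G)"
  shows "interval_measure G = density lborel (\<lambda>x. ennreal (deriv G x))"
proof -
  have mono: "G x \<le> G y" if "x \<le> y" for x y
    using G that by (auto simp: cdf_function_def mono_def)
  have rc: "continuous (at_right x) G" for x
    using G by (auto simp: cdf_function_def)
  have lim: "(G \<longlongrightarrow> 0) at_bot" "(G \<longlongrightarrow> 1) at_top"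
    using G by (auto simp: cdf_function_def)
  have nonneg: "0 \<le> deriv G x" for x
    by (rule mono_on_imp_deriv_nonneg[OF _ diff, where A=UNIV]) (auto intro: mono_onI mono)
  have meas: "deriv G \<in> borel_measurable borel"
    by (rule borel_measurable_continuous_onI[OF cont])
  show ?thesis
  proof (rule measure_eqI_generator_eq[where \<Omega>=UNIV and A="\<lambda>i::nat. {- real i<..real i}"
        and E="range (\<lambda>(a, b). {a<..b::real})"])
    fix X assume "X \<in> range (\<lambda>(a, b). {a<..b::real})"
    then obtain a b where X: "X = {a<..b}" by auto
    show "emeasure (interval_measure G) X = emeasure (density lborel (\<lambda>x. ennreal (deriv G x))) X"
    proof (cases "a \<le> b")
      case True
      have "emeasure (density lborel (\<lambda>x. ennreal (deriv G x))) X
          = (\<integral>\<^sup>+x. ennreal (deriv G x) * indicator {a<..b} x \<partial>lborel)"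
        using meas X by (simp add: emeasure_density)
      also have "\<dots> = (\<integral>\<^sup>+x. ennreal (deriv G x) * indicator {a..b} x \<partial>lborel)"
        by (rule nn_integral_cong_AE, use AE_lborel_singleton[of a] in eventually_elim)
           (auto simp: indicator_def)
      also have "\<dots> = G b - G a"
        by (rule nn_integral_FTC_Icc[OF meas]) (auto intro: diff nonneg has_field_derivative_at_within True
            simp: has_real_derivative_iff_has_vector_derivative[symmetric])
      finally show ?thesis
        using X True mono rc by (simp add: emeasure_interval_measure_Ioc)
    qed (simp add: X)
  next
    show "(\<Union>i. {- real (i::nat)<..real i}) = UNIV"
      by (rule UN_Ioc_eq_UNIV)
  qed (auto simp: borel_sigma_sets_Ioc Int_stable_def emeasure_interval_measure_Ioc mono rc)
qed

lemma cdf_moment_eq_deriv: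
  assumes "cdf_function G"
    and "\<And>x. (G has_real_derivative deriv G x) (at x)"
    and "continuous_on UNIV (deriv G)"
  shows "cdf_moment G p = (LINT u|lborel. u ^ p * deriv G u)"
proof -
  have nonneg: "0 \<le> deriv G x" for x
    by (rule mono_on_imp_deriv_nonneg[OF _ assms(2), where A=UNIV])
      (use assms(1) in \<open>auto simp: cdf_function_def mono_def mono_on_def\<close>)
  show ?thesis
    unfolding cdf_moment_def interval_measure_eq_density[OF assms]
    by (subst integral_density)
      (auto simp: nonneg mult.commute intro: borel_measurable_continuous_onI[OF assms(3)])
qed

text \<open>The kernel \<open>K\<close> is a distribution function such that the distributions described by \<open>K\<close> and
  \<open>K\<^sup>2\<close> have first and second moments.\<close>

definition cdf_kernel :: "(real \<Rightarrow> real) \<Rightarrow> bool" where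
  "cdf_kernel K \<longleftrightarrow> cdf_function K \<and>
     (\<forall>p\<in>{1, 2::nat}. integrable (interval_measure K) (\<lambda>u. u ^ p) \<and>
                      integrable (interval_measure (\<lambda>u. (K u)\<^sup>2)) (\<lambda>u. u ^ p))"

definition twice_continuously_differentiable :: "(real \<Rightarrow> real) \<Rightarrow> bool" where
  "twice_continuously_differentiable F \<longleftrightarrow>
     (\<forall>x. F field_differentiable (at x)) \<and>
     (\<forall>x. deriv F field_differentiable (at x)) \<and>
     continuous_on UNIV (deriv (deriv F))"

definition quantile :: "(real \<Rightarrow> real) \<Rightarrow> real \<Rightarrow> real" where
  "quantile F q = Inf {x. q \<le> F x}"

text \<open>The domain of integration: the real line for the full MISE, an upper tail for the
  \<open>q\<close>-quantile version.\<close>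

definition mise_domain :: "(real \<Rightarrow> real) \<Rightarrow> real set \<Rightarrow> bool" where
  "mise_domain F S \<longleftrightarrow> S = UNIV \<or> (\<exists>q. 0 < q \<and> q < 1 \<and> S = {quantile F q..})"

section \<open>Coefficients of the expansion\<close>

text \<open>In this section \<open>F\<close> is the distribution function of the observations, \<open>deriv F\<close> their
  density, and \<open>n\<close> the size of a block. The coefficients depend on the block only through \<open>n\<close>.
  The subtractions of natural numbers in the exponents never truncate. Those in \<open>N - 1\<close>, \<open>N - 2\<close>
  do so only for \<open>N = 1\<close> in \<open>E2b\<close>, where \<open>N choose 2 = 0\<close>.\<close>

definition coeff_alpha :: "(real \<Rightarrow> real) \<Rightarrow> (real \<Rightarrow> real) \<Rightarrow> real \<Rightarrow> real" where
  "coeff_alpha F K y =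
     deriv F y * cdf_moment (\<lambda>u. (K u)\<^sup>2) 1 - 2 * F y * deriv F y * cdf_moment K 1"

definition coeff_beta :: "(real \<Rightarrow> real) \<Rightarrow> (real \<Rightarrow> real) \<Rightarrow> real \<Rightarrow> real" where
  "coeff_beta F K y =
     1/2 * deriv (deriv F) y * cdf_moment (\<lambda>u. (K u)\<^sup>2) 2
     - deriv (deriv F) y * F y * cdf_moment K 2
     - (deriv F y)\<^sup>2 * (cdf_moment K 1)\<^sup>2"

text \<open>\<open>(2k - 1)!!\<close>, with \<open>(-1)!! = 1\<close>.\<close>

definition odd_double_fact :: "nat \<Rightarrow> nat" where
  "odd_double_fact k = (\<Prod>i=1..k. 2 * i - 1)"

definition Y0 :: "(real \<Rightarrow> real) \<Rightarrow> nat \<Rightarrow> nat \<Rightarrow> real \<Rightarrow> real" where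
  "Y0 F n N y =
     (\<Sum>k=0..N div 2. real (N choose (2*k)) * real (odd_double_fact k) / real n ^ k
        * F y ^ (N - k) * (1 - F y) ^ k)"

definition Y1 :: "(real \<Rightarrow> real) \<Rightarrow> (real \<Rightarrow> real) \<Rightarrow> nat \<Rightarrow> nat \<Rightarrow> real \<Rightarrow> real" where
  "Y1 F K n N y =
     - (\<Sum>k=1..N div 2. real k * real (N choose (2*k)) * real (odd_double_fact k) / real n ^ k
          * F y ^ (N - k - 1) * (1 - F y) ^ (k - 1) * coeff_alpha F K y)"

definition Y2alpha :: "(real \<Rightarrow> real) \<Rightarrow> (real \<Rightarrow> real) \<Rightarrow> nat \<Rightarrow> nat \<Rightarrow> real \<Rightarrow> real" where
  "Y2alpha F K n N y =
     (\<Sum>k=2..N div 2. real (N choose (2*k)) * real (odd_double_fact k)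
        * (real k * (real k - 1) / 2) / real n ^ k
        * F y ^ (N - k - 2) * (1 - F y) ^ (k - 2) * (coeff_alpha F K y)\<^sup>2)"

definition Y2beta :: "(real \<Rightarrow> real) \<Rightarrow> (real \<Rightarrow> real) \<Rightarrow> nat \<Rightarrow> nat \<Rightarrow> real \<Rightarrow> real" where
  "Y2beta F K n N y =
     (\<Sum>k=1..N div 2. real k * real (N choose (2*k)) * real (odd_double_fact k) / real n ^ k
        * F y ^ (N - k - 1) * (1 - F y) ^ (k - 1) * coeff_beta F K y)"

definition E0 :: "(real \<Rightarrow> real) \<Rightarrow> nat \<Rightarrow> nat \<Rightarrow> real \<Rightarrow> real" where
  "E0 F n N y = Y0 F n N y"

definition E1 :: "(real \<Rightarrow> real) \<Rightarrow> (real \<Rightarrow> real) \<Rightarrow> nat \<Rightarrow> nat \<Rightarrow> real \<Rightarrow> real" where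
  "E1 F K n N y = Y1 F K n N y - real N * deriv F y * cdf_moment K 1 * Y0 F n (N - 1) y"

definition E2a :: "(real \<Rightarrow> real) \<Rightarrow> (real \<Rightarrow> real) \<Rightarrow> nat \<Rightarrow> nat \<Rightarrow> real \<Rightarrow> real" where
  "E2a F K n N y =
     Y2beta F K n N y + real N / 2 * deriv (deriv F) y * cdf_moment K 2 * Y0 F n (N - 1) y"

definition E2b :: "(real \<Rightarrow> real) \<Rightarrow> (real \<Rightarrow> real) \<Rightarrow> nat \<Rightarrow> nat \<Rightarrow> real \<Rightarrow> real" where
  "E2b F K n N y =
     Y2alpha F K n N y - real N * deriv F y * cdf_moment K 1 * Y1 F K n (N - 1) y
     + real (N choose 2) * (deriv F y)\<^sup>2 * (cdf_moment K 1)\<^sup>2 * Y0 F n (N - 2) y"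

definition b0 :: "(real \<Rightarrow> real) \<Rightarrow> nat \<Rightarrow> real \<Rightarrow> real" where
  "b0 F n y = E0 F n n y - F y ^ n"

definition b1 :: "(real \<Rightarrow> real) \<Rightarrow> (real \<Rightarrow> real) \<Rightarrow> nat \<Rightarrow> real \<Rightarrow> real" where
  "b1 F K n y = E1 F K n n y"

definition b2a :: "(real \<Rightarrow> real) \<Rightarrow> (real \<Rightarrow> real) \<Rightarrow> nat \<Rightarrow> real \<Rightarrow> real" where
  "b2a F K n y = E2a F K n n y"

definition b2b :: "(real \<Rightarrow> real) \<Rightarrow> (real \<Rightarrow> real) \<Rightarrow> nat \<Rightarrow> real \<Rightarrow> real" where
  "b2b F K n y = E2b F K n n y"

definition b2 :: "(real \<Rightarrow> real) \<Rightarrow> (real \<Rightarrow> real) \<Rightarrow> nat \<Rightarrow> real \<Rightarrow> real" where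
  "b2 F K n y = b2a F K n y + b2b F K n y"

definition V0 :: "(real \<Rightarrow> real) \<Rightarrow> nat \<Rightarrow> real \<Rightarrow> real" where
  "V0 F n y = E0 F n (2*n) y - (E0 F n n y)\<^sup>2"

definition V1 :: "(real \<Rightarrow> real) \<Rightarrow> (real \<Rightarrow> real) \<Rightarrow> nat \<Rightarrow> real \<Rightarrow> real" where
  "V1 F K n y = E1 F K n (2*n) y - 2 * E0 F n n y * E1 F K n n y"

definition V2a :: "(real \<Rightarrow> real) \<Rightarrow> (real \<Rightarrow> real) \<Rightarrow> nat \<Rightarrow> real \<Rightarrow> real" where
  "V2a F K n y = E2a F K n (2*n) y - 2 * E0 F n n y * E2a F K n n y"

definition V2b :: "(real \<Rightarrow> real) \<Rightarrow> (real \<Rightarrow> real) \<Rightarrow> nat \<Rightarrow> real \<Rightarrow> real" where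
  "V2b F K n y =
     E2b F K n (2*n) y - 2 * E0 F n n y * E2b F K n n y - (E1 F K n n y)\<^sup>2"

definition V2 :: "(real \<Rightarrow> real) \<Rightarrow> (real \<Rightarrow> real) \<Rightarrow> nat \<Rightarrow> real \<Rightarrow> real" where
  "V2 F K n y = V2a F K n y + V2b F K n y"

section \<open>Second-order approximation of the MISE\<close>

text \<open>The blocks are indexed by a finite type \<open>'m\<close>, so \<open>m = CARD('m)\<close>. Block \<open>i\<close> has size \<open>n i\<close>.
  Individual bandwidths are given by \<open>H :: 'm \<Rightarrow> nat \<Rightarrow> real\<close>, of which only the values
  \<open>H i j\<close> with \<open>1 \<le> j \<le> n i\<close> are relevant.\<close>

definition mean_bw :: "('m \<Rightarrow> nat) \<Rightarrow> ('m \<Rightarrow> nat \<Rightarrow> real) \<Rightarrow> 'm \<Rightarrow> real" where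
  "mean_bw n H i = (\<Sum>j=1..n i. H i j) / real (n i)"

definition mean_sq_bw :: "('m \<Rightarrow> nat) \<Rightarrow> ('m \<Rightarrow> nat \<Rightarrow> real) \<Rightarrow> 'm \<Rightarrow> real" where
  "mean_sq_bw n H i = (\<Sum>j=1..n i. (H i j)\<^sup>2) / real (n i)"

text \<open>The expansion, up to third-order terms in the bandwidths, of the mean squared error at \<open>y\<close> of
  \<open>y \<mapsto> 1/m \<Sum>\<^sub>i (1/n\<^sub>i \<Sum>\<^sub>j K ((y - X\<^sub>i\<^sub>j) / h\<^sub>i\<^sub>j))^(n\<^sub>i)\<close> as an estimator of \<open>1/m \<Sum>\<^sub>i F y^(n\<^sub>i)\<close>,
  when the central moments of the inner averages are approximated by normal ones.\<close>

definition mse_approx ::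
  "(real \<Rightarrow> real) \<Rightarrow> (real \<Rightarrow> real) \<Rightarrow> ('m::finite \<Rightarrow> nat) \<Rightarrow> ('m \<Rightarrow> nat \<Rightarrow> real) \<Rightarrow> real \<Rightarrow> real" where
  "mse_approx F K n H y = 1 / (real CARD('m))\<^sup>2 *
     ((\<Sum>i\<in>UNIV. b0 F (n i) y)\<^sup>2
      + (\<Sum>i\<in>UNIV. V0 F (n i) y)
      + 2 * (\<Sum>i\<in>UNIV. b0 F (n i) y) * (\<Sum>i\<in>UNIV. mean_bw n H i * b1 F K (n i) y)
      + (\<Sum>i\<in>UNIV. mean_bw n H i * V1 F K (n i) y)
      + (\<Sum>i\<in>UNIV. mean_bw n H i * b1 F K (n i) y)\<^sup>2
      + 2 * (\<Sum>i\<in>UNIV. b0 F (n i) y)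
          * (\<Sum>i\<in>UNIV. mean_sq_bw n H i * b2a F K (n i) y + (mean_bw n H i)\<^sup>2 * b2b F K (n i) y)
      + (\<Sum>i\<in>UNIV. mean_sq_bw n H i * V2a F K (n i) y + (mean_bw n H i)\<^sup>2 * V2b F K (n i) y))"

definition mise_approx ::
  "real set \<Rightarrow> (real \<Rightarrow> real) \<Rightarrow> (real \<Rightarrow> real) \<Rightarrow> ('m::finite \<Rightarrow> nat) \<Rightarrow> ('m \<Rightarrow> nat \<Rightarrow> real) \<Rightarrow> real" where
  "mise_approx S F K n H = (LINT y:S|lborel. mse_approx F K n H y)"

definition bandwidth_matrix :: "('m \<Rightarrow> nat) \<Rightarrow> ('m \<Rightarrow> nat \<Rightarrow> real) \<Rightarrow> bool" where
  "bandwidth_matrix n H \<longleftrightarrow> (\<forall>i. \<forall>j\<in>{1..n i}. 0 < H i j)"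

definition bandwidth_vector :: "real ^ 'm \<Rightarrow> bool" where
  "bandwidth_vector h \<longleftrightarrow> (\<forall>i. 0 < h $ i)"

definition block_constant :: "real ^ 'm \<Rightarrow> 'm \<Rightarrow> nat \<Rightarrow> real" where
  "block_constant h = (\<lambda>i j. h $ i)"

text \<open>\<open>x\<close> is \<^emph>\<open>the\<close> minimizer of \<open>f\<close> among the points satisfying \<open>P\<close>.\<close>

definition is_unique_arg_min :: "('a \<Rightarrow> real) \<Rightarrow> ('a \<Rightarrow> bool) \<Rightarrow> 'a \<Rightarrow> bool" where
  "is_unique_arg_min f P x \<longleftrightarrow> is_arg_min f P x \<and> (\<forall>y. is_arg_min f P y \<longrightarrow> y = x)"

end

theory Submission
  imports Defs
begin

text \<open>The expansion depends on the bandwidths only through the block means \<open>a\<^sub>i\<close> and the block variances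
  \<open>w\<^sub>i \<ge> 0\<close>: writing each mean square as \<open>a\<^sub>i\<^sup>2 + w\<^sub>i\<close> gives, up to a positive factor,
  \<open>C + c \<bullet> a + a \<bullet> Q a + \<Sum>\<^sub>i w\<^sub>i d\<^sub>i\<close>. Block-constant bandwidths are those with \<open>w = 0\<close>, so
  for them a quadratic polynomial has to be minimized over an open set; its minimizer is a critical
  point, and it can be unique only if \<open>Q\<close> has no kernel, as the polynomial is constant along kernel
  directions through a critical point. Perturbing a single bandwidth changes \<open>w\<close>
  only to second order, hence the stationarity. If some \<open>d\<^sub>i < 0\<close> with \<open>n\<^sub>i \<ge> 2\<close>, the value can always be lowered by spreading two bandwidths of the block
  with their mean fixed, so there is no minimizer; otherwise \<open>w = 0\<close> is best.\<close>

section \<open>Quadratic polynomials\<close>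

definition quad_poly :: "real \<Rightarrow> real ^ 'm \<Rightarrow> real ^ 'm ^ 'm \<Rightarrow> real ^ 'm \<Rightarrow> real" where
  "quad_poly C c Q v = C + c \<bullet> v + v \<bullet> (Q *v v)"

lemma inner_symmetric_matrix:
  fixes Q :: "real ^ 'm ^ 'm"
  assumes "transpose Q = Q"
  shows "x \<bullet> (Q *v y) = y \<bullet> (Q *v x)"
  by (metis assms dot_lmul_matrix inner_commute transpose_matrix_vector)

lemma quad_poly_add:
  assumes "transpose Q = Q"
  shows "quad_poly C c Q (v + w) = quad_poly C c Q v + w \<bullet> (c + 2 *\<^sub>R (Q *v v)) + w \<bullet> (Q *v w)"
  using inner_symmetric_matrix[OF assms, of v w]
  by (simp add: quad_poly_def matrix_vector_right_distrib inner_add_left inner_add_right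
      inner_commute algebra_simps)

lemma quad_poly_add_scaleR:
  assumes "transpose Q = Q"
  shows "quad_poly C c Q (v + t *\<^sub>R w)
    = quad_poly C c Q v + t * (w \<bullet> (c + 2 *\<^sub>R (Q *v v))) + t\<^sup>2 * (w \<bullet> (Q *v w))"
  unfolding quad_poly_add[OF assms]
  by (simp add: matrix_vector_mult_scaleR power2_eq_square)

lemma has_derivative_quad_poly_line:
  assumes "transpose Q = Q"
  shows "((\<lambda>t. quad_poly C c Q (v + t *\<^sub>R w)) has_real_derivative w \<bullet> (c + 2 *\<^sub>R (Q *v v))) (at 0)"
  unfolding quad_poly_add_scaleR[OF assms] by (auto intro!: derivative_eq_intros)

lemma quad_poly_critical:
  assumes "transpose Q = Q" "c + 2 *\<^sub>R (Q *v v) = 0"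
  shows "quad_poly C c Q w = quad_poly C c Q v + (w - v) \<bullet> (Q *v (w - v))"
  using quad_poly_add[OF assms(1), of C c v "w - v"] assms(2) by simp

text \<open>Positivity of the entries is an open condition, so a positive vector can be moved a
  little in every direction, as arguments by directional derivatives require.\<close>

lemma bandwidth_vector_perturb:
  fixes h w :: "real ^ 'm::finite"
  assumes "bandwidth_vector h"
  shows "eventually (\<lambda>t. bandwidth_vector (h + t *\<^sub>R w)) (at 0)"
  unfolding bandwidth_vector_def
proof (rule eventually_all_finite)
  fix i
  have "((\<lambda>t. h $ i + t * w $ i) \<longlongrightarrow> h $ i + 0 * w $ i) (at 0)"
    by (intro tendsto_intros)
  then have "eventually (\<lambda>t. 0 < h $ i + t * w $ i) (at 0)"
    using assms by (intro order_tendstoD(1)) (auto simp: bandwidth_vector_def)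
  then show "eventually (\<lambda>t. 0 < (h + t *\<^sub>R w) $ i) (at 0)"
    by simp
qed

lemma quad_poly_arg_min_critical:
  fixes h :: "real ^ 'm::finite"
  assumes sym: "transpose Q = Q"
    and min: "is_arg_min (quad_poly C c Q) bandwidth_vector h"
  shows "c + 2 *\<^sub>R (Q *v h) = 0"
proof -
  define w where "w = c + 2 *\<^sub>R (Q *v h)"
  have le: "quad_poly C c Q h \<le> quad_poly C c Q v" if "bandwidth_vector v" for v
    using min that by (auto simp: is_arg_min_def not_less)
  have h: "bandwidth_vector h"
    using min by (simp add: is_arg_min_def)
  obtain e where e: "e > 0" "\<And>t. t \<noteq> 0 \<Longrightarrow> dist t 0 < e \<Longrightarrow> bandwidth_vector (h + t *\<^sub>R w)"
    using bandwidth_vector_perturb[OF h, of w] by (auto simp: eventually_at)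
  \<comment> \<open>The direction chosen is the gradient \<open>w\<close> itself, so the directional
    derivative at the minimizer is its squared length.\<close>
  have "w \<bullet> w = 0"
  proof (rule DERIV_local_min)
    show "((\<lambda>t. quad_poly C c Q (h + t *\<^sub>R w)) has_real_derivative w \<bullet> w) (at 0)"
      using has_derivative_quad_poly_line[OF sym, of C c h w] by (simp add: w_def)
    show "\<forall>t. \<bar>0 - t\<bar> < e \<longrightarrow> quad_poly C c Q (h + 0 *\<^sub>R w) \<le> quad_poly C c Q (h + t *\<^sub>R w)"
    proof (intro allI impI)
      fix t :: real assume "\<bar>0 - t\<bar> < e"
      then show "quad_poly C c Q (h + 0 *\<^sub>R w) \<le> quad_poly C c Q (h + t *\<^sub>R w)"
        using e(2)[of t] by (cases "t = 0") (auto intro: le)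
    qed
  qed (rule e)
  then show ?thesis by (simp add: w_def)
qed

lemma matrix_inv_mult_vector:
  fixes Q :: "real ^ 'm::finite ^ 'm"
  assumes "invertible Q"
  shows "matrix_inv Q *v (Q *v x) = x" "Q *v (matrix_inv Q *v x) = x"
proof -
  \<comment> \<open>\<open>matrix_inv\<close> is a Hilbert choice; invertibility guarantees that the
    chosen matrix is a two-sided inverse.\<close>
  have "Q ** matrix_inv Q = mat 1 \<and> matrix_inv Q ** Q = mat 1"
    using assms unfolding invertible_def matrix_inv_def by (rule someI_ex)
  then show "matrix_inv Q *v (Q *v x) = x" "Q *v (matrix_inv Q *v x) = x"
    by (simp_all add: matrix_vector_mul_assoc)
qed

lemma critical_point_eq_matrix_inv:
  fixes Q :: "real ^ 'm::finite ^ 'm"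
  assumes "invertible Q"
  shows "c + 2 *\<^sub>R (Q *v h) = 0 \<longleftrightarrow> h = - (1/2) *\<^sub>R (matrix_inv Q *v c)"
proof
  assume "c + 2 *\<^sub>R (Q *v h) = 0"
  then have c: "c = Q *v ((- 2) *\<^sub>R h)"
    unfolding matrix_vector_mult_scaleR by (simp add: eq_neg_iff_add_eq_0)
  show "h = - (1/2) *\<^sub>R (matrix_inv Q *v c)"
    unfolding c matrix_inv_mult_vector[OF assms] by simp
next
  assume h: "h = - (1/2) *\<^sub>R (matrix_inv Q *v c)"
  show "c + 2 *\<^sub>R (Q *v h) = 0"
    unfolding h matrix_vector_mult_scaleR matrix_inv_mult_vector[OF assms] by simp
qed

lemma quad_poly_unique_arg_min_invertible:
  fixes h :: "real ^ 'm::finite"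
  assumes sym: "transpose Q = Q"
    and min: "is_unique_arg_min (quad_poly C c Q) bandwidth_vector h"
  shows "invertible Q"
proof (rule ccontr)
  have am: "is_arg_min (quad_poly C c Q) bandwidth_vector h"
    and uniq: "\<And>v. is_arg_min (quad_poly C c Q) bandwidth_vector v \<Longrightarrow> v = h"
    using min by (auto simp: is_unique_arg_min_def)
  have h: "bandwidth_vector h" using am by (simp add: is_arg_min_def)
  note crit = quad_poly_arg_min_critical[OF sym am]
  assume "\<not> invertible Q"
  then obtain w where w: "w \<noteq> 0" "Q *v w = 0"
    unfolding invertible_left_inverse matrix_left_invertible_ker by blast
  \<comment> \<open>A small nonzero step along the kernel vector stays in the positive orthant and
    yields a second minimizer.\<close>
  have "eventually (\<lambda>t. bandwidth_vector (h + t *\<^sub>R w) \<and> t \<noteq> 0) (at (0::real))"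
    using bandwidth_vector_perturb[OF h] by (intro eventually_conj) (auto simp: eventually_at_filter)
  then obtain t :: real where t: "bandwidth_vector (h + t *\<^sub>R w)" "t \<noteq> 0"
    using eventually_happens'[OF at_neq_bot] by blast
  have "quad_poly C c Q (h + t *\<^sub>R w) = quad_poly C c Q h"
    unfolding quad_poly_add_scaleR[OF sym] crit w by simp
  then have "is_arg_min (quad_poly C c Q) bandwidth_vector (h + t *\<^sub>R w)"
    using am t by (simp add: is_arg_min_def)
  from uniq[OF this] show False using w t by simp
qed

lemma pos_def_invertible:
  fixes Q :: "real ^ 'm::finite ^ 'm"
  assumes "\<And>v. v \<noteq> 0 \<Longrightarrow> 0 < v \<bullet> (Q *v v)"
  shows "invertible Q"
  unfolding invertible_left_inverse matrix_left_invertible_ker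
  using assms by (metis inner_zero_right less_irrefl)

text \<open>At a critical point the expansion has no linear term, so the excess over the value at
  \<open>h\<close> is the quadratic form of \<open>v - h\<close>, positive unless
  \<open>v = h\<close>.\<close>

lemma quad_poly_pos_def_unique_arg_min:
  fixes h :: "real ^ 'm::finite"
  assumes sym: "transpose Q = Q"
    and pd: "\<And>v. v \<noteq> 0 \<Longrightarrow> 0 < v \<bullet> (Q *v v)"
    and crit: "c + 2 *\<^sub>R (Q *v h) = 0"
    and "bandwidth_vector h"
  shows "is_unique_arg_min (quad_poly C c Q) bandwidth_vector h"
proof -
  have "quad_poly C c Q h < quad_poly C c Q v" if "v \<noteq> h" for v
    using quad_poly_critical[OF sym crit, of C v] pd[of "v - h"] that by simp
  then have "quad_poly C c Q h \<le> quad_poly C c Q v" "quad_poly C c Q v \<le> quad_poly C c Q h \<Longrightarrow> v = h" for v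
    by (cases "v = h"; force simp: less_imp_le)+
  then show ?thesis
    using assms(4) by (auto simp: is_unique_arg_min_def is_arg_min_def not_less)
qed

section \<open>Mean and variance of the bandwidths in a block\<close>

definition bw_var :: "('m \<Rightarrow> nat) \<Rightarrow> ('m \<Rightarrow> nat \<Rightarrow> real) \<Rightarrow> 'm \<Rightarrow> real" where
  "bw_var n H i = mean_sq_bw n H i - (mean_bw n H i)\<^sup>2"

definition mean_bw_vec :: "('m::finite \<Rightarrow> nat) \<Rightarrow> ('m \<Rightarrow> nat \<Rightarrow> real) \<Rightarrow> real ^ 'm" where
  "mean_bw_vec n H = (\<chi> i. mean_bw n H i)"

text \<open>This is Cauchy-Schwarz. For an empty block both means are 0 because division by zero
  gives 0.\<close>

lemma bw_var_nonneg: "0 \<le> bw_var n H i"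
proof (cases "n i = 0")
  case False
  have "(\<Sum>j=1..n i. H i j)\<^sup>2 \<le> real (n i) * (\<Sum>j=1..n i. (H i j)\<^sup>2)"
    using sum_squared_le_sum_of_squares[of "H i" "{1..n i}"] by (simp add: mult.commute)
  then show ?thesis
    using False by (simp add: bw_var_def mean_bw_def mean_sq_bw_def field_simps power2_eq_square)
qed (simp add: bw_var_def mean_bw_def mean_sq_bw_def)

lemma bw_var_singleton: "n i = 1 \<Longrightarrow> bw_var n H i = 0"
  by (simp add: bw_var_def mean_bw_def mean_sq_bw_def)

lemma mean_bw_vec_block_constant:
  assumes "\<And>i. 0 < n i"
  shows "mean_bw_vec n (block_constant h) = h"
  using assms by (simp add: vec_eq_iff mean_bw_vec_def mean_bw_def block_constant_def)

lemma bw_var_block_constant: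
  assumes "0 < n i"
  shows "bw_var n (block_constant h) i = 0"
  using assms by (simp add: bw_var_def mean_bw_def mean_sq_bw_def block_constant_def)

lemma bandwidth_vector_mean_bw_vec:
  assumes "\<And>i. 0 < n i" "bandwidth_matrix n H"
  shows "bandwidth_vector (mean_bw_vec n H)"
  using assms
  by (auto simp: bandwidth_vector_def bandwidth_matrix_def mean_bw_vec_def mean_bw_def
      intro!: divide_pos_pos sum_pos Suc_leI)

lemma bandwidth_matrix_block_constant: "bandwidth_vector h \<Longrightarrow> bandwidth_matrix n (block_constant h)"
  by (simp add: bandwidth_vector_def bandwidth_matrix_def block_constant_def)

lemma sum_fun_upd:
  fixes g :: "'b \<Rightarrow> real"
  assumes "finite A" "j \<in> A"
  shows "(\<Sum>l\<in>A. g ((f(j := t)) l)) = (\<Sum>l\<in>A. g (f l)) + (g t - g (f j))"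
proof -
  have "(\<Sum>l\<in>A - {j}. g ((f(j := t)) l)) = (\<Sum>l\<in>A - {j}. g (f l))"
    by (rule sum.cong) auto
  then show ?thesis
    by (simp add: sum.remove[OF assms])
qed

lemma mean_bw_upd:
  assumes "j \<in> {1..n i}"
  shows "mean_bw n (H(i := (H i)(j := t))) k = mean_bw n H k + of_bool (k = i) * (t - H i j) / real (n i)"
  using sum_fun_upd[OF _ assms, of "\<lambda>x. x" "H i" t]
  by (auto simp: mean_bw_def add_divide_distrib)

lemma mean_sq_bw_upd:
  assumes "j \<in> {1..n i}"
  shows "mean_sq_bw n (H(i := (H i)(j := t))) k
    = mean_sq_bw n H k + of_bool (k = i) * (t\<^sup>2 - (H i j)\<^sup>2) / real (n i)"
  using sum_fun_upd[OF _ assms, of "\<lambda>x. x\<^sup>2" "H i" t]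
  by (auto simp: mean_sq_bw_def add_divide_distrib)

lemma mean_bw_vec_upd:
  assumes "j \<in> {1..n i}"
  shows "mean_bw_vec n (H(i := (H i)(j := t)))
    = mean_bw_vec n H + ((t - H i j) / real (n i)) *\<^sub>R axis i 1"
  by (auto simp: vec_eq_iff mean_bw_vec_def mean_bw_upd[where n=n, OF assms] axis_def)

text \<open>A change by \<open>x\<close> of one of \<open>n i\<close> equal bandwidths contributes
  \<open>x^2 / n i\<close> to the mean square beyond its linear part, and
  \<open>x^2 / (n i)^2\<close> to the squared mean; the linear parts cancel. The variance is thus of
  second order in the change.\<close>

lemma bw_var_block_constant_upd:
  assumes "\<And>i. 0 < n i" "j \<in> {1..n i}"
  shows "bw_var n ((block_constant h)(i := (block_constant h i)(j := t))) k
    = of_bool (k = i) * ((t - h $ i)\<^sup>2 * (1 / real (n i) - 1 / (real (n i))\<^sup>2))"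
proof -
  have "mean_bw n (block_constant h) k = h $ k" "mean_sq_bw n (block_constant h) k = (h $ k)\<^sup>2"
    using assms(1)[of k] by (simp_all add: mean_bw_def mean_sq_bw_def block_constant_def)
  then show ?thesis
    using assms(1)[of i]
    unfolding bw_var_def mean_bw_upd[where n=n, OF assms(2)] mean_sq_bw_upd[where n=n, OF assms(2)]
    by (cases "k = i") (simp_all add: block_constant_def field_simps power2_eq_square)
qed

text \<open>Moving two bandwidths of a block apart by equal amounts keeps their sum and raises the
  sum of their squares.\<close>

lemma bandwidth_matrix_spread:
  assumes n: "2 \<le> n i" and H: "bandwidth_matrix n H"
  obtains H' where "bandwidth_matrix n H'" "mean_bw_vec n H' = mean_bw_vec n H"
    "\<And>k. k \<noteq> i \<Longrightarrow> bw_var n H' k = bw_var n H k" "bw_var n H i < bw_var n H' i"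
proof -
  \<comment> \<open>Ordering the pair ensures that lowering \<open>H i p\<close> and raising
    \<open>H i q\<close> increases the distance between them.\<close>
  obtain p q where pq: "p \<in> {1..n i}" "q \<in> {1..n i}" "p \<noteq> q" "H i p \<le> H i q"
  proof (cases "H i 1 \<le> H i 2")
    case True with n show ?thesis by (intro that[of 1 2]) auto
  next
    case False with n show ?thesis by (intro that[of 2 1]) auto
  qed
  \<comment> \<open>Half of the smaller bandwidth is a shift that keeps it positive.\<close>
  define e where "e = H i p / 2"
  have e: "e > 0" "e < H i p"
    using H pq by (auto simp: bandwidth_matrix_def e_def)
  define H1 where "H1 = H(i := (H i)(p := H i p - e))"
  define H2 where "H2 = H1(i := (H1 i)(q := H i q + e))"
  have H1q: "H1 i q = H i q"
    using pq by (simp add: H1_def)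
  have mean: "mean_bw n H2 k = mean_bw n H k" for k
    unfolding H2_def mean_bw_upd[where n=n, OF pq(2)] H1q
    by (simp add: H1_def mean_bw_upd[where n=n, OF pq(1)])
  have sq: "mean_sq_bw n H2 k = mean_sq_bw n H k
      + of_bool (k = i) * ((2 * e * (H i q - H i p) + 2 * e\<^sup>2) / real (n i))" for k
    unfolding H2_def mean_sq_bw_upd[where n=n, OF pq(2)] H1q
    using n by (simp add: H1_def mean_sq_bw_upd[where n=n, OF pq(1)])
      (simp add: field_simps power2_eq_square)
  show thesis
  proof (rule that[of H2])
    show "bandwidth_matrix n H2"
      using H e pq by (auto simp: bandwidth_matrix_def H2_def H1_def add_pos_pos)
    show "mean_bw_vec n H2 = mean_bw_vec n H"
      by (simp add: mean_bw_vec_def mean)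
    show "bw_var n H2 k = bw_var n H k" if "k \<noteq> i" for k
      using that by (simp add: bw_var_def mean sq)
    have "0 < (2 * e * (H i q - H i p) + 2 * e\<^sup>2) / real (n i)"
      using e pq n by (intro divide_pos_pos add_nonneg_pos) auto
    then show "bw_var n H i < bw_var n H2 i"
      by (simp add: bw_var_def mean sq)
  qed
qed

lemma set_integrable_sum:
  fixes f :: "'i \<Rightarrow> 'a \<Rightarrow> 'b::{banach, second_countable_topology}"
  assumes "\<And>i. i \<in> I \<Longrightarrow> set_integrable M A (f i)"
  shows "set_integrable M A (\<lambda>x. \<Sum>i\<in>I. f i x)"
    and "(LINT x:A|M. \<Sum>i\<in>I. f i x) = (\<Sum>i\<in>I. LINT x:A|M. f i x)"
  using assms
  by (simp_all add: set_integrable_def set_lebesgue_integral_def scaleR_sum_right)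

section \<open>The approximation as a quadratic polynomial in means plus a variance term\<close>

text \<open>The coefficients here and below omit the common factor \<open>1 / m^2\<close>, which
  stays outside the polynomial.\<close>

definition mse_const :: "(real \<Rightarrow> real) \<Rightarrow> ('m::finite \<Rightarrow> nat) \<Rightarrow> real \<Rightarrow> real" where
  "mse_const F n y = (\<Sum>i\<in>UNIV. b0 F (n i) y)\<^sup>2 + (\<Sum>i\<in>UNIV. V0 F (n i) y)"

definition mse_lin ::
  "(real \<Rightarrow> real) \<Rightarrow> (real \<Rightarrow> real) \<Rightarrow> ('m::finite \<Rightarrow> nat) \<Rightarrow> real \<Rightarrow> real ^ 'm" where
  "mse_lin F K n y = (\<chi> i. 2 * (\<Sum>j\<in>UNIV. b0 F (n j) y) * b1 F K (n i) y + V1 F K (n i) y)"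

definition mse_quad ::
  "(real \<Rightarrow> real) \<Rightarrow> (real \<Rightarrow> real) \<Rightarrow> ('m::finite \<Rightarrow> nat) \<Rightarrow> real \<Rightarrow> real ^ 'm ^ 'm" where
  "mse_quad F K n y = (\<chi> k l. b1 F K (n k) y * b1 F K (n l) y
     + of_bool (k = l) * (2 * (\<Sum>j\<in>UNIV. b0 F (n j) y) * b2 F K (n k) y + V2 F K (n k) y))"

text \<open>Only the \<open>2a\<close> coefficients enter, since they alone multiply the mean square
  and hence the variance of a block.\<close>

definition mse_var ::
  "(real \<Rightarrow> real) \<Rightarrow> (real \<Rightarrow> real) \<Rightarrow> ('m::finite \<Rightarrow> nat) \<Rightarrow> 'm \<Rightarrow> real \<Rightarrow> real" where
  "mse_var F K n i y = 2 * (\<Sum>j\<in>UNIV. b0 F (n j) y) * b2a F K (n i) y + V2a F K (n i) y"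

lemma transpose_mse_quad: "transpose (mse_quad F K n y) = mse_quad F K n y"
  by (auto simp: vec_eq_iff transpose_def mse_quad_def)

text \<open>Each mean square is split into squared mean plus variance. The squared means merge the
  \<open>2a\<close> and \<open>2b\<close> coefficients on the diagonal; the square of the linear sum
  gives the rank-one matrix of products of the \<open>b1\<close>.\<close>

lemma mse_approx_eq_quad_poly:
  fixes n :: "'m::finite \<Rightarrow> nat"
  shows "mse_approx F K n H y = 1 / (real CARD('m))\<^sup>2 *
     (quad_poly (mse_const F n y) (mse_lin F K n y) (mse_quad F K n y) (mean_bw_vec n H)
      + (\<Sum>i\<in>UNIV. bw_var n H i * mse_var F K n i y))"
proof -
  define B where "B = (\<Sum>i\<in>UNIV. b0 F (n i) y)"
  define a where "a = mean_bw n H"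
  define G where "G i = 2 * B * b2 F K (n i) y + V2 F K (n i) y" for i
  have "mean_bw_vec n H \<bullet> (mse_quad F K n y *v mean_bw_vec n H)
      = (\<Sum>k\<in>UNIV. \<Sum>l\<in>UNIV. a k * b1 F K (n k) y * (a l * b1 F K (n l) y)
          + (if k = l then (a k)\<^sup>2 * G k else 0))"
    unfolding inner_vec_def matrix_vector_mult_def mse_quad_def mean_bw_vec_def
    by (auto simp: sum_distrib_left a_def G_def B_def algebra_simps power2_eq_square intro!: sum.cong)
  also have "\<dots> = (\<Sum>i\<in>UNIV. a i * b1 F K (n i) y)\<^sup>2 + (\<Sum>i\<in>UNIV. (a i)\<^sup>2 * G i)"
    by (simp add: sum.distrib power2_eq_square sum_product)
  finally have quad: "mean_bw_vec n H \<bullet> (mse_quad F K n y *v mean_bw_vec n H) = \<dots>" .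
  show ?thesis
    unfolding quad_poly_def quad
    by (simp add: mse_approx_def mse_const_def mse_lin_def mse_var_def mean_bw_vec_def inner_vec_def
        bw_var_def a_def G_def B_def b2_def V2_def sum.distrib sum_distrib_left sum_subtractf algebra_simps)
qed

section \<open>Integrability of the separate coefficients, and the integrated quadratic
  polynomial\<close>

context
  fixes F K :: "real \<Rightarrow> real" and n :: "'m::finite \<Rightarrow> nat" and S :: "real set"
  assumes n_pos: "\<And>i. 0 < n i"
    and integrable: "\<And>H. bandwidth_matrix n H \<Longrightarrow> set_integrable lborel S (mse_approx F K n H)"
begin

lemma set_integrable_scaled:
  assumes "bandwidth_matrix n H"
  shows "set_integrable lborel S (\<lambda>y.
     quad_poly (mse_const F n y) (mse_lin F K n y) (mse_quad F K n y) (mean_bw_vec n H)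
      + (\<Sum>i\<in>UNIV. bw_var n H i * mse_var F K n i y))"
proof -
  have "set_integrable lborel S (\<lambda>y. (real CARD('m))\<^sup>2 * mse_approx F K n H y)"
    by (intro set_integrable_mult_right integrable assms)
  then show ?thesis
    unfolding mse_approx_eq_quad_poly by simp
qed

text \<open>The assumption gives integrability of the whole expansion only. Block-constant
  bandwidths remove the variance term and realize every positive vector, so finite differences of
  these polynomials can isolate the coefficients.\<close>

lemma set_integrable_quad_poly:
  assumes "bandwidth_vector h"
  shows "set_integrable lborel S
    (\<lambda>y. quad_poly (mse_const F n y) (mse_lin F K n y) (mse_quad F K n y) h)"
  using set_integrable_scaled[OF bandwidth_matrix_block_constant[OF assms]]
  by (simp add: mean_bw_vec_block_constant bw_var_block_constant n_pos)

text \<open>Only positive bandwidths are available, so the entries of the matrix are isolated by second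
  differences at \<open>1\<close> in the positive directions \<open>axis k 1\<close> and \<open>axis l 1\<close>.\<close>

lemma set_integrable_mse_quad: "set_integrable lborel S (\<lambda>y. mse_quad F K n y $ k $ l)"
proof -
  let ?q = "\<lambda>v y. quad_poly (mse_const F n y) (mse_lin F K n y) (mse_quad F K n y) v"
  let ?e = "\<lambda>i. axis i 1 :: real ^ 'm"
  have "set_integrable lborel S (\<lambda>y. (?q (1 + ?e k + ?e l) y - ?q (1 + ?e k) y) - (?q (1 + ?e l) y - ?q 1 y))"
    by (intro set_integral_diff set_integrable_quad_poly)
      (auto simp: bandwidth_vector_def axis_def)
  moreover have "(?q (1 + ?e k + ?e l) y - ?q (1 + ?e k) y) - (?q (1 + ?e l) y - ?q 1 y)
      = 2 * mse_quad F K n y $ k $ l" for y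
    unfolding quad_poly_add[OF transpose_mse_quad]
    using inner_symmetric_matrix[OF transpose_mse_quad, of "?e l" F K n y "?e k"]
    by (simp add: matrix_vector_right_distrib inner_add_right inner_axis' matrix_vector_mul_component inner_axis)
  ultimately show ?thesis by simp
qed

text \<open>The first difference at the all-ones vector towards \<open>axis i 1\<close> is the
  wanted coefficient plus twice a row sum and a diagonal entry of the matrix, which are already
  integrable.\<close>

lemma set_integrable_mse_lin: "set_integrable lborel S (\<lambda>y. mse_lin F K n y $ i)"
proof -
  let ?q = "\<lambda>v y. quad_poly (mse_const F n y) (mse_lin F K n y) (mse_quad F K n y) v"
  let ?e = "axis i 1 :: real ^ 'm"
  have "set_integrable lborel S (\<lambda>y. (?q (1 + ?e) y - ?q 1 y)
      - (2 * (\<Sum>l\<in>UNIV. mse_quad F K n y $ i $ l) + mse_quad F K n y $ i $ i))"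
    by (intro set_integral_diff set_integral_add set_integrable_quad_poly set_integrable_sum(1)
        set_integrable_mult_right set_integrable_mse_quad)
      (auto simp: bandwidth_vector_def axis_def)
  moreover have "(?q (1 + ?e) y - ?q 1 y)
      - (2 * (\<Sum>l\<in>UNIV. mse_quad F K n y $ i $ l) + mse_quad F K n y $ i $ i) = mse_lin F K n y $ i" for y
    unfolding quad_poly_add[OF transpose_mse_quad]
    by (simp add: inner_add_right inner_axis' matrix_vector_mul_component inner_axis) (simp add: inner_vec_def)
  ultimately show ?thesis by simp
qed

lemma set_integrable_mse_const: "set_integrable lborel S (mse_const F n)"
proof -
  let ?q = "\<lambda>v y. quad_poly (mse_const F n y) (mse_lin F K n y) (mse_quad F K n y) v"
  have "set_integrable lborel S (\<lambda>y. ?q 1 y - ((\<Sum>i\<in>UNIV. mse_lin F K n y $ i)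
      + (\<Sum>k\<in>UNIV. \<Sum>l\<in>UNIV. mse_quad F K n y $ k $ l)))"
    by (intro set_integral_diff set_integral_add set_integrable_quad_poly set_integrable_sum(1)
        set_integrable_mse_lin set_integrable_mse_quad) (auto simp: bandwidth_vector_def)
  then show ?thesis
    by (simp add: quad_poly_def inner_vec_def matrix_vector_mult_def)
qed

lemma set_integrable_mse_var:
  assumes "2 \<le> n i"
  shows "set_integrable lborel S (mse_var F K n i)"
proof -
  define w where "w = 1 / real (n i) - 1 / (real (n i))\<^sup>2"
  have w: "w \<noteq> 0"
    using assms by (simp add: w_def field_simps power2_eq_square)
  \<comment> \<open>One bandwidth equal to 2 among ones gives block \<open>i\<close> the variance
    \<open>w\<close>, nonzero as \<open>2 \<le> n i\<close>, and every other block variance 0.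
    Subtracting the polynomial at the mean vector leaves \<open>w\<close> times the wanted
    function.\<close>
  define H where "H = (block_constant (1 :: real ^ 'm))(i := (block_constant (1 :: real ^ 'm) i)(1 := 2))"
  have one: "1 \<in> {1..n i}" using assms by simp
  have "bandwidth_matrix n H"
    by (auto simp: bandwidth_matrix_def H_def block_constant_def)
  note int = set_integrable_scaled[OF this]
  have "bandwidth_vector (mean_bw_vec n H)"
    by (intro bandwidth_vector_mean_bw_vec n_pos) fact
  note int' = set_integral_diff(1)[OF int set_integrable_quad_poly[OF this]]
  have "bw_var n H k = (if k = i then w else 0)" for k
    unfolding H_def bw_var_block_constant_upd[where n=n, OF n_pos one] by (simp add: w_def)
  then have "(\<Sum>k\<in>UNIV. bw_var n H k * mse_var F K n k y) = w * mse_var F K n i y" for y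
    by (simp add: if_distribR if_distrib[of "\<lambda>x. x * _"] cong: if_cong)
  with int' have "set_integrable lborel S (\<lambda>y. w * mse_var F K n i y)" by simp
  with w show ?thesis by simp
qed

lemma mise_approx_eq_quad_poly:
  "mise_approx S F K n H = 1 / (real CARD('m))\<^sup>2 *
     (quad_poly (LINT y:S|lborel. mse_const F n y) (\<chi> i. LINT y:S|lborel. mse_lin F K n y $ i)
        (\<chi> k l. LINT y:S|lborel. mse_quad F K n y $ k $ l) (mean_bw_vec n H)
      + (\<Sum>i\<in>UNIV. bw_var n H i * (LINT y:S|lborel. mse_var F K n i y)))"
proof -
  have var: "set_integrable lborel S (\<lambda>y. bw_var n H i * mse_var F K n i y)" for i
  proof (cases "2 \<le> n i")
    \<comment> \<open>In a block of size one the variance is 0, so the product is the zero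
      function.\<close>
    case False
    then have "bw_var n H i = 0" using n_pos[of i] by (intro bw_var_singleton) simp
    then show ?thesis by (simp add: set_integrable_def)
  qed (simp add: set_integrable_mse_var)
  note ints = set_integrable_mse_const set_integrable_mse_lin set_integrable_mse_quad var
  show ?thesis
    unfolding mise_approx_def mse_approx_eq_quad_poly quad_poly_def inner_vec_def matrix_vector_mult_def
    by (simp add: ints set_integral_add(2) set_integrable_sum sum_distrib_left mult.assoc[symmetric])
qed

end


section \<open>Minimizers over block-constant and over individual bandwidths\<close>

lemma is_unique_arg_min_mult:
  fixes s :: real
  assumes "0 < s"
  shows "is_unique_arg_min (\<lambda>x. s * f x) P x \<longleftrightarrow> is_unique_arg_min f P x"
  using assms by (simp add: is_unique_arg_min_def is_arg_min_def)

context
  fixes n :: "'m::finite \<Rightarrow> nat" and J :: "('m \<Rightarrow> nat \<Rightarrow> real) \<Rightarrow> real"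
    and s C :: real and c h :: "real ^ 'm" and Q :: "real ^ 'm ^ 'm" and d :: "'m \<Rightarrow> real"
  assumes n_pos: "\<And>i. 0 < n i" and s: "0 < s"
    and J: "\<And>H. J H = s * (quad_poly C c Q (mean_bw_vec n H) + (\<Sum>i\<in>UNIV. bw_var n H i * d i))"
begin

text \<open>The mean vector moves along \<open>axis i 1\<close>, where criticality removes the
  linear term, and the variance is quadratic in the change. Hence \<open>J\<close> is a constant
  plus a multiple of \<open>(t - h $ i)^2\<close>.\<close>

lemma stationary_individual_bandwidth:
  assumes sym: "transpose Q = Q" and crit: "c + 2 *\<^sub>R (Q *v h) = 0" and j: "j \<in> {1..n i}"
  shows "((\<lambda>t. J ((block_constant h)(i := (block_constant h i)(j := t)))) has_real_derivative 0) (at (h $ i))"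
proof -
  have "J ((block_constant h)(i := (block_constant h i)(j := t))) = s * (quad_poly C c Q h
      + ((t - h $ i) / real (n i))\<^sup>2 * (axis i 1 \<bullet> (Q *v axis i 1))
      + (t - h $ i)\<^sup>2 * ((1 / real (n i) - 1 / (real (n i))\<^sup>2) * d i))" for t
  proof -
    have hi: "block_constant h i j = h $ i" by (simp add: block_constant_def)
    have var: "(\<Sum>k\<in>UNIV. of_bool (k = i) * x * d k) = x * d i" for x :: real
      by (simp add: of_bool_def if_distribR if_distrib[of "\<lambda>x. x * _"] cong: if_cong)
    show ?thesis
      unfolding J mean_bw_vec_upd[where n=n, OF j] bw_var_block_constant_upd[where n=n, OF n_pos j] hi
        mean_bw_vec_block_constant[where n=n, OF n_pos] quad_poly_add_scaleR[OF sym] crit var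
      by (simp add: mult.assoc)
  qed
  then show ?thesis
    using n_pos[of i] by (simp only:) (auto intro!: derivative_eq_intros)
qed

text \<open>If \<open>d i\<close> were negative, spreading block \<open>i\<close> would raise its
  variance alone, with all means fixed, and lower \<open>J\<close> below its minimum.\<close>

lemma arg_min_bandwidth_matrix_nonneg:
  assumes H: "is_arg_min J (bandwidth_matrix n) H" and i: "2 \<le> n i"
  shows "0 \<le> d i"
proof (rule ccontr)
  assume neg: "\<not> 0 \<le> d i"
  have "bandwidth_matrix n H" using H by (simp add: is_arg_min_def)
  then obtain H' where H': "bandwidth_matrix n H'" "mean_bw_vec n H' = mean_bw_vec n H"
    "\<And>k. k \<noteq> i \<Longrightarrow> bw_var n H' k = bw_var n H k" "bw_var n H i < bw_var n H' i"
    using bandwidth_matrix_spread[where n=n, OF i] by blast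
  have "(\<Sum>k\<in>UNIV. bw_var n H' k * d k) < (\<Sum>k\<in>UNIV. bw_var n H k * d k)"
  proof (rule sum_strict_mono_ex1)
    show "\<forall>k\<in>UNIV. bw_var n H' k * d k \<le> bw_var n H k * d k"
    proof
      fix k show "bw_var n H' k * d k \<le> bw_var n H k * d k"
        using H'(3)[of k] H'(4) neg by (cases "k = i") (auto intro: mult_right_mono_neg)
    qed
    show "\<exists>k\<in>UNIV. bw_var n H' k * d k < bw_var n H k * d k"
      using H'(4) neg by (intro bexI[of _ i]) (auto intro: mult_strict_right_mono_neg)
  qed simp
  then have "J H' < J H"
    using s by (simp add: J H'(2))
  with H H'(1) show False by (auto simp: is_arg_min_def)
qed

text \<open>Both summands are minimal separately: the polynomial because mean vectors are positive,
  the variance term because it is nonnegative and vanishes at block-constant bandwidths. Blocks of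
  size one contribute 0 whatever the sign of \<open>d i\<close>.\<close>

lemma block_constant_arg_min:
  assumes h: "is_arg_min (quad_poly C c Q) bandwidth_vector h"
    and d: "\<And>i. 2 \<le> n i \<Longrightarrow> 0 \<le> d i"
  shows "is_arg_min J (bandwidth_matrix n) (block_constant h)"
proof -
  have "J (block_constant h) \<le> J H" if H: "bandwidth_matrix n H" for H
  proof -
    have "quad_poly C c Q h \<le> quad_poly C c Q (mean_bw_vec n H)"
      using h bandwidth_vector_mean_bw_vec[where n=n, OF n_pos H] by (auto simp: is_arg_min_def not_less)
    moreover have "0 \<le> bw_var n H i * d i" for i
    proof (cases "2 \<le> n i")
      case False
      then have "bw_var n H i = 0" using n_pos[of i] by (intro bw_var_singleton) simp
      then show ?thesis by simp
    qed (simp add: d bw_var_nonneg)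
    then have "0 \<le> (\<Sum>i\<in>UNIV. bw_var n H i * d i)" by (simp add: sum_nonneg)
    ultimately show ?thesis
      using s by (simp add: J mean_bw_vec_block_constant[where n=n, OF n_pos]
          bw_var_block_constant[where n=n, OF n_pos])
  qed
  then show ?thesis
    using h by (auto simp: is_arg_min_def not_less bandwidth_matrix_block_constant)
qed

end

text \<open>A minimizer may fail to exist, so the formula is stated in two directions: a unique
  block-constant minimizer forces it, and with positive definite \<open>Q\<close> and positive
  entries it gives that minimizer. Global optimality is stationarity in each bandwidth, plus
  minimality whenever any minimizer exists, with a sign criterion for existence.\<close>

theorem theorem2p2:
  fixes P :: "'a measure"
    and X :: "'m::finite \<Rightarrow> nat \<Rightarrow> 'a \<Rightarrow> real"
    and n :: "'m \<Rightarrow> nat"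
    and F K :: "real \<Rightarrow> real"
    and S :: "real set"
    and c h_opt :: "real ^ 'm"
    and Q :: "real ^ 'm ^ 'm"
  assumes "prob_space P"
    and "\<And>i. 0 < n i"
    and "prob_space.indep_vars P (\<lambda>_. borel) (\<lambda>(i, j). X i j) (SIGMA i:UNIV. {1..n i})"
    and "\<And>i j. j \<in> {1..n i} \<Longrightarrow> cdf (distr P borel (X i j)) = F"
    and "twice_continuously_differentiable F"
    and "cdf_kernel K"
    and "mise_domain F S"
    and "\<And>H. bandwidth_matrix n H \<Longrightarrow> set_integrable lborel S (mse_approx F K n H)"
    and "\<And>i. c $ i =
           (LINT y:S|lborel. 2 * (\<Sum>j\<in>UNIV. b0 F (n j) y) * b1 F K (n i) y + V1 F K (n i) y)"
    and "\<And>k l. Q $ k $ l =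
           (LINT y:S|lborel. b1 F K (n k) y * b1 F K (n l) y
              + of_bool (k = l) * (2 * (\<Sum>j\<in>UNIV. b0 F (n j) y) * b2 F K (n k) y + V2 F K (n k) y))"
  shows
    \<comment> \<open>\<open>c\<close> and \<open>Q\<close> collect the linear and quadratic terms in \<open>h\<close>\<close>
    "(\<exists>C. \<forall>h. bandwidth_vector h \<longrightarrow>
        mise_approx S F K n (block_constant h)
          = 1 / (real CARD('m))\<^sup>2 * (C + c \<bullet> h + h \<bullet> (Q *v h))) \<and>
     \<comment> \<open>the minimizer among the block-constant bandwidths\<close>
     (is_unique_arg_min (\<lambda>h. mise_approx S F K n (block_constant h)) bandwidth_vector h_opt \<longrightarrow>
        invertible Q \<and> h_opt = - (1/2) *\<^sub>R (matrix_inv Q *v c)) \<and>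
     (bandwidth_vector h_opt \<and> h_opt = - (1/2) *\<^sub>R (matrix_inv Q *v c) \<and>
      (\<forall>v. v \<noteq> 0 \<longrightarrow> 0 < v \<bullet> (Q *v v)) \<longrightarrow>
        is_unique_arg_min (\<lambda>h. mise_approx S F K n (block_constant h)) bandwidth_vector h_opt) \<and>
     \<comment> \<open>optimality with respect to all individual bandwidths\<close>
     (is_unique_arg_min (\<lambda>h. mise_approx S F K n (block_constant h)) bandwidth_vector h_opt \<longrightarrow>
        (\<forall>i. \<forall>j\<in>{1..n i}.
           ((\<lambda>t. mise_approx S F K n
                   ((block_constant h_opt)(i := (block_constant h_opt i)(j := t))))
              has_real_derivative 0) (at (h_opt $ i))) \<and>
        ((\<exists>H. is_arg_min (mise_approx S F K n) (bandwidth_matrix n) H) \<longrightarrow>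
           is_arg_min (mise_approx S F K n) (bandwidth_matrix n) (block_constant h_opt)) \<and>
        ((\<exists>H. is_arg_min (mise_approx S F K n) (bandwidth_matrix n) H) \<longleftrightarrow>
           (\<forall>i. 2 \<le> n i \<longrightarrow>
              0 \<le> (LINT y:S|lborel.
                      2 * (\<Sum>j\<in>UNIV. b0 F (n j) y) * b2a F K (n i) y + V2a F K (n i) y))))"
proof -
  note n_pos = assms(2) and int = assms(8)
  define s where "s = 1 / (real CARD('m))\<^sup>2"
  define C where "C = (LINT y:S|lborel. mse_const F n y)"
  define d where "d i = (LINT y:S|lborel. mse_var F K n i y)" for i
  define J where "J = mise_approx S F K n"
  have s: "0 < s" by (simp add: s_def)
  have c: "c = (\<chi> i. LINT y:S|lborel. mse_lin F K n y $ i)"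
    by (simp add: vec_eq_iff assms(9) mse_lin_def)
  have Q: "Q = (\<chi> k l. LINT y:S|lborel. mse_quad F K n y $ k $ l)"
    by (simp add: vec_eq_iff assms(10) mse_quad_def)
  have sym: "transpose Q = Q"
    using transpose_mse_quad[of F K n] by (simp add: Q vec_eq_iff transpose_def)
  have J: "J H = s * (quad_poly C c Q (mean_bw_vec n H) + (\<Sum>i\<in>UNIV. bw_var n H i * d i))" for H
    unfolding J_def s_def C_def c Q d_def by (rule mise_approx_eq_quad_poly[OF n_pos int])
  have block: "J (block_constant h) = s * quad_poly C c Q h" for h
    by (simp add: J mean_bw_vec_block_constant n_pos bw_var_block_constant)
  \<comment> \<open>The positive factor \<open>s\<close> does not affect minimizers, so
    block-constant minimization becomes a question about \<open>quad_poly C c Q\<close>.\<close>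
  have uniq: "is_unique_arg_min (\<lambda>h. J (block_constant h)) bandwidth_vector h
      \<longleftrightarrow> is_unique_arg_min (quad_poly C c Q) bandwidth_vector h" for h
    unfolding block by (rule is_unique_arg_min_mult[OF s])
  have crit: "c + 2 *\<^sub>R (Q *v h_opt) = 0"
    if "is_unique_arg_min (quad_poly C c Q) bandwidth_vector h_opt"
    using that unfolding is_unique_arg_min_def by (blast intro: quad_poly_arg_min_critical[OF sym])
  show ?thesis
    unfolding J_def[symmetric] uniq mse_var_def[symmetric] d_def[symmetric] s_def[symmetric]
  proof (intro conjI impI)
    show "\<exists>C. \<forall>h. bandwidth_vector h \<longrightarrow> J (block_constant h) = s * (C + c \<bullet> h + h \<bullet> (Q *v h))"
      unfolding block quad_poly_def by blast
  next
    assume "is_unique_arg_min (quad_poly C c Q) bandwidth_vector h_opt"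
    then show "invertible Q"
      by (rule quad_poly_unique_arg_min_invertible[OF sym])
  next
    assume min: "is_unique_arg_min (quad_poly C c Q) bandwidth_vector h_opt"
    show "h_opt = - (1/2) *\<^sub>R (matrix_inv Q *v c)"
      using crit[OF min] critical_point_eq_matrix_inv[OF quad_poly_unique_arg_min_invertible[OF sym min]]
      by blast
  next
    assume opt: "bandwidth_vector h_opt \<and> h_opt = - (1/2) *\<^sub>R (matrix_inv Q *v c) \<and>
      (\<forall>v. v \<noteq> 0 \<longrightarrow> 0 < v \<bullet> (Q *v v))"
    then have pd: "0 < v \<bullet> (Q *v v)" if "v \<noteq> 0" for v using that by blast
    have "c + 2 *\<^sub>R (Q *v h_opt) = 0"
      using opt critical_point_eq_matrix_inv[OF pos_def_invertible[OF pd]] by blast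
    with opt show "is_unique_arg_min (quad_poly C c Q) bandwidth_vector h_opt"
      by (intro quad_poly_pos_def_unique_arg_min[OF sym pd]) auto
  next
    assume "is_unique_arg_min (quad_poly C c Q) bandwidth_vector h_opt"
    then show "\<forall>i. \<forall>j\<in>{1..n i}. ((\<lambda>t. J ((block_constant h_opt)(i := (block_constant h_opt i)(j := t))))
        has_real_derivative 0) (at (h_opt $ i))"
      by (intro allI ballI stationary_individual_bandwidth[OF n_pos s J sym crit])
  next
    assume "is_unique_arg_min (quad_poly C c Q) bandwidth_vector h_opt"
    then have am: "is_arg_min (quad_poly C c Q) bandwidth_vector h_opt"
      by (simp add: is_unique_arg_min_def)
    \<comment> \<open>Any minimizer forces the signs of the \<open>d i\<close> in blocks of size at
      least two, and these signs make the block-constant point a minimizer; both remaining claims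
      follow.\<close>
    note nonneg = arg_min_bandwidth_matrix_nonneg[OF n_pos s J]
      and arg_min = block_constant_arg_min[OF n_pos s J am]
    show "is_arg_min J (bandwidth_matrix n) (block_constant h_opt)"
      if "\<exists>H. is_arg_min J (bandwidth_matrix n) H"
      using that nonneg by (blast intro: arg_min)
    show "(\<exists>H. is_arg_min J (bandwidth_matrix n) H) \<longleftrightarrow> (\<forall>i. 2 \<le> n i \<longrightarrow> 0 \<le> d i)"
      using nonneg arg_min by blast
  qed
qed

end
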